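(* Let $\vec\alpha\,F$ be an $n$-ary BNF and $\sim$ a type-polymorphic family of relations on $\vec\alpha\,F$ which at every type is an equivalence relation, satisfies $x\sim y\Rightarrow\mathrm{map}_F\,\vec f\,x\sim\mathrm{map}_F\,\vec f\,y$ for all $\vec f$, and satisfies conditions (WI) and (PP) below at all types. Let $\mathrm{rel}_Q$ be as defined below. Then for all $x,y$ and relations $\vec R$, $$([x]_\sim,[y]_\sim)\in\mathrm{rel}_Q\,\vec R\iff(\mathrm{map}_F\,\vec{\mathfrak e}\,x,\ \mathrm{map}_F\,\vec{\mathfrak e}\,y)\in\big({\sim}\bullet\mathrm{rel}_F\,\overrightarrow{(\mathrm{rel}_{\mathsf 1+}\,R)}\bullet{\sim}\big).$$
   Context: HOL setting (all types non-empty); vector notation $\vec x=x_1,\dots,x_n$. Relations are identified with sets of pairs and $\bullet$ is relation composition. An $n$-ary BNF is a type constructor $\vec\alpha\,F$ with polymorphic mapper $\mathrm{map}_F::(\alpha_1\to\beta_1)\to\cdots\to(\alpha_n\to\beta_n)\to\vec\alpha\,F\to\vec\beta\,F$, setters $\mathrm{set}_{F,i}::\vec\alpha\,F\to\alpha_i\ \mathrm{set}$, infinite cardinal bound $\mathrm{bd}_F$, relator $\mathrm{rel}_F$, satisfying: $\mathrm{map}_F\,\vec{\mathrm{id}}=\mathrm{id}$; $\mathrm{map}_F\,\vec g\circ\mathrm{map}_F\,\vec f=\mathrm{map}_F\,\overrightarrow{(g\circ f)}$; $\mathrm{set}_{F,i}(\mathrm{map}_F\,\vec f\,x)=f_i\langle\mathrm{set}_{F,i}\,x\rangle$;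 if $f_i z=g_i z$ for all $i$ and $z\in\mathrm{set}_{F,i}\,x$ then $\mathrm{map}_F\,\vec f\,x=\mathrm{map}_F\,\vec g\,x$; $|\mathrm{set}_{F,i}\,x|\le\mathrm{bd}_F$; $(x,y)\in\mathrm{rel}_F\,\vec R$ iff some $z$ has $\mathrm{set}_{F,i}\,z\subseteq R_i$ for all $i$, $\mathrm{map}_F\,\overrightarrow{\mathrm{fst}}\,z=x$, $\mathrm{map}_F\,\overrightarrow{\mathrm{snd}}\,z=y$; $\mathrm{rel}_F\,\vec R\bullet\mathrm{rel}_F\,\vec S\subseteq\mathrm{rel}_F\,\overrightarrow{(R\bullet S)}$. Notation: $f\langle X\rangle$ image, $f^{-1}\langle X\rangle$ preimage; $F_{\mathrm{in}}\,\vec A=\{x\mid\forall i.\ \mathrm{set}_{F,i}\,x\subseteq A_i\}$; $[x]_\sim=\{y\mid x\sim y\}$, $[A]_\sim=\{[x]_\sim\mid x\in A\}$, $\bigcup[A]_\sim$ = set of elements equivalent to some element of $A$. (WI): for all families $\mathcal A_1,\dots,\mathcal A_n$ with $\mathcal A_i\neq\emptyset$ and $\bigcap\mathcal A_i\neq\emptyset$ for all $i$, $\bigcap\{[F_{\mathrm{in}}\,\vec A]_\sim\mid\forall i.\ A_i\in\mathcal A_i\}\subseteq\big[\bigcap\{F_{\mathrm{in}}\,\vec A\mid\forall i.\ A_i\in\mathcal A_i\}\big]_\sim$. (PP): for all $\vec f$ and $\vec A$ with $f_i^{-1}\langle A_i\rangle\neq\emptyset$ for all $i$, $(\mathrm{map}_F\,\vec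 f)^{-1}\langle\bigcup[F_{\mathrm{in}}\,\vec A]_\sim\rangle\subseteq\bigcup[(\mathrm{map}_F\,\vec f)^{-1}\langle F_{\mathrm{in}}\,\vec A\rangle]_\sim$. $\mathsf 1+\alpha$ is the sum of the unit type and $\alpha$, with $\circledast$ the left injection of the unit element and $\mathfrak e::\alpha\to\mathsf 1+\alpha$ the right injection; $\mathrm{rel}_{\mathsf 1+}\,R=\{(\circledast,\circledast)\}\cup\{(\mathfrak e\,a,\mathfrak e\,b)\mid(a,b)\in R\}$. The quotient $\vec\alpha\,Q$ consists of the classes $[x]_\sim$, with $\mathrm{map}_Q\,\vec f\,[x]_\sim=[\mathrm{map}_F\,\vec f\,x]_\sim$; $Q_{\mathrm{in}}\,\vec A=\{q\mid\forall\vec f\,\vec g.\ (\forall i.\ \forall a\in A_i.\ f_i\,a=g_i\,a)\longrightarrow\mathrm{map}_Q\,\vec f\,q=\mathrm{map}_Q\,\vec g\,q\}$ with $f_i,g_i::\alpha_i\to\mathsf 1+\alpha_i$; $\mathrm{set}_{Q,i}\,q=\bigcap\{A_i\mid q\in Q_{\mathrm{in}}\,\mathrm{UNIV}\cdots A_i\cdots\mathrm{UNIV}\}$ ($A_i$ at position $i$, $\mathrm{UNIV}$ elsewhere); and $(q,r)\in\mathrm{rel}_Q\,\vec R$ iff there exists $p$ with $\mathrm{set}_{Q,i}\,p\subseteq R_i$ for all $i$, $\mathrm{map}_Q\,\overrightarrow{\mathrm{fst}}\,p=q$ and $\mathrm{map}_Q\,\overrightarrow{\mathrm{snd}}\,p=r$.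 *)

theory Defs
  imports Main
begin

unbundle cardinal_syntax

section \<open>A universe of types\<close>

text \<open>
  A statement about an arbitrary type constructor of arbitrary arity quantifies over type
  constructors and over all their type instances, which HOL types cannot express. Types are
  therefore represented semantically, as in the standard set-theoretic semantics of HOL: a type is
  a nonempty set of values taken from a universe \<open>T\<close> of types, a type constructor is a function from
  tuples of types to sets, and a polymorphic constant is a family indexed by tuples of types. The
  atoms range over an arbitrary HOL type. Tuples are functions on a finite index type \<open>'n\<close>, so the
  arity is \<open>CARD('n)\<close>.
\<close>

datatype 'a val =
    Atom 'a
  | Unit
  | Pair (pfst: "'a val") (psnd: "'a val")
  | Inl "'a val"
  | Inr "'a val"

definition prod_ty :: "'a val set \<Rightarrow> 'a val set \<Rightarrow> 'a val set" where
  "prod_ty A B = {Pair a b | a b. a \<in> A \<and> b \<in> B}"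

definition sum_ty :: "'a val set \<Rightarrow> 'a val set \<Rightarrow> 'a val set" where
  "sum_ty A B = Inl ` A \<union> Inr ` B"

definition one_plus :: "'a val set \<Rightarrow> 'a val set" where
  "one_plus A = sum_ty {Unit} A"

abbreviation star :: "'a val" where
  "star \<equiv> Inl Unit"

abbreviation emb :: "'a val \<Rightarrow> 'a val" where
  "emb \<equiv> Inr"

text \<open>
  Only the closure properties needed to write down the notions below are required of a universe,
  so that quantifying over all universes covers in particular those closed under all type formers
  of HOL.
\<close>

definition type_universe :: "'a val set set \<Rightarrow> bool" where
  "type_universe T \<longleftrightarrow>
     (\<forall>A\<in>T. A \<noteq> {}) \<and>
     (\<forall>A\<in>T. \<forall>B\<in>T. prod_ty A B \<in> T) \<and>
     (\<forall>A\<in>T. one_plus A \<in> T)"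

type_synonym ('n, 'a) types = "'n \<Rightarrow> 'a val set"

definition type_tuples :: "'a val set set \<Rightarrow> ('n, 'a) types set" where
  "type_tuples T = {\<alpha>. \<forall>i. \<alpha> i \<in> T}"

definition funs :: "('n, 'a) types \<Rightarrow> ('n, 'a) types \<Rightarrow> ('n \<Rightarrow> 'a val \<Rightarrow> 'a val) set" where
  "funs \<alpha> \<beta> = {f. \<forall>i. f i ` \<alpha> i \<subseteq> \<beta> i}"

definition rels :: "('n, 'a) types \<Rightarrow> ('n, 'a) types \<Rightarrow> ('n \<Rightarrow> ('a val \<times> 'a val) set) set" where
  "rels \<alpha> \<beta> = {R. \<forall>i. R i \<subseteq> \<alpha> i \<times> \<beta> i}"

abbreviation prods :: "('n, 'a) types \<Rightarrow> ('n, 'a) types \<Rightarrow> ('n, 'a) types" where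
  "prods \<alpha> \<beta> \<equiv> (\<lambda>i. prod_ty (\<alpha> i) (\<beta> i))"

abbreviation one_pluses :: "('n, 'a) types \<Rightarrow> ('n, 'a) types" where
  "one_pluses \<alpha> \<equiv> (\<lambda>i. one_plus (\<alpha> i))"

text \<open>The set of elements of the product type that a relation corresponds to.\<close>

definition rel_graph :: "('a val \<times> 'a val) set \<Rightarrow> 'a val set" where
  "rel_graph R = {Pair a b | a b. (a, b) \<in> R}"

definition rel_one_plus :: "('a val \<times> 'a val) set \<Rightarrow> ('a val \<times> 'a val) set" where
  "rel_one_plus R = {(star, star)} \<union> {(emb a, emb b) | a b. (a, b) \<in> R}"


section \<open>Bounded natural functors\<close>

text \<open>
  The elements of \<open>F\<close> live in an arbitrary HOL type \<open>'f\<close>, as no notion below applies a type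
  constructor to an instance of \<open>F\<close>.
\<close>

record ('n, 'a, 'f) functor_ops =
  carr :: "('n, 'a) types \<Rightarrow> 'f set"
  fmap :: "('n, 'a) types \<Rightarrow> ('n, 'a) types \<Rightarrow> ('n \<Rightarrow> 'a val \<Rightarrow> 'a val) \<Rightarrow> 'f \<Rightarrow> 'f"
  fset :: "('n, 'a) types \<Rightarrow> 'n \<Rightarrow> 'f \<Rightarrow> 'a val set"

definition rel_F ::
  "('n, 'a, 'f) functor_ops \<Rightarrow> ('n, 'a) types \<Rightarrow> ('n, 'a) types \<Rightarrow>
   ('n \<Rightarrow> ('a val \<times> 'a val) set) \<Rightarrow> ('f \<times> 'f) set" where
  "rel_F F \<alpha> \<beta> R =
     {(x, y). \<exists>z \<in> carr F (prods \<alpha> \<beta>).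
        (\<forall>i. fset F (prods \<alpha> \<beta>) i z \<subseteq> rel_graph (R i)) \<and>
        fmap F (prods \<alpha> \<beta>) \<alpha> (\<lambda>_. pfst) z = x \<and>
        fmap F (prods \<alpha> \<beta>) \<beta> (\<lambda>_. psnd) z = y}"

locale BNF =
  fixes T :: "'a val set set"
    and F :: "('n::finite, 'a, 'f) functor_ops"
    and bd :: "'b rel"
  assumes carr_nonempty: "\<alpha> \<in> type_tuples T \<Longrightarrow> carr F \<alpha> \<noteq> {}"
    and map_closed:
      "\<lbrakk>\<alpha> \<in> type_tuples T; \<beta> \<in> type_tuples T; f \<in> funs \<alpha> \<beta>; x \<in> carr F \<alpha>\<rbrakk>
       \<Longrightarrow> fmap F \<alpha> \<beta> f x \<in> carr F \<beta>"
    and set_closed: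
      "\<lbrakk>\<alpha> \<in> type_tuples T; x \<in> carr F \<alpha>\<rbrakk> \<Longrightarrow> fset F \<alpha> i x \<subseteq> \<alpha> i"
    and map_id:
      "\<lbrakk>\<alpha> \<in> type_tuples T; x \<in> carr F \<alpha>\<rbrakk> \<Longrightarrow> fmap F \<alpha> \<alpha> (\<lambda>_. id) x = x"
    and map_comp:
      "\<lbrakk>\<alpha> \<in> type_tuples T; \<beta> \<in> type_tuples T; \<gamma> \<in> type_tuples T;
        f \<in> funs \<alpha> \<beta>; g \<in> funs \<beta> \<gamma>; x \<in> carr F \<alpha>\<rbrakk>
       \<Longrightarrow> fmap F \<beta> \<gamma> g (fmap F \<alpha> \<beta> f x) = fmap F \<alpha> \<gamma> (\<lambda>i. g i \<circ> f i) x"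
    and set_map:
      "\<lbrakk>\<alpha> \<in> type_tuples T; \<beta> \<in> type_tuples T; f \<in> funs \<alpha> \<beta>; x \<in> carr F \<alpha>\<rbrakk>
       \<Longrightarrow> fset F \<beta> i (fmap F \<alpha> \<beta> f x) = f i ` fset F \<alpha> i x"
    and map_cong:
      "\<lbrakk>\<alpha> \<in> type_tuples T; \<beta> \<in> type_tuples T; f \<in> funs \<alpha> \<beta>; g \<in> funs \<alpha> \<beta>; x \<in> carr F \<alpha>;
        \<forall>i. \<forall>z \<in> fset F \<alpha> i x. f i z = g i z\<rbrakk>
       \<Longrightarrow> fmap F \<alpha> \<beta> f x = fmap F \<alpha> \<beta> g x"
    and bd_Card_order: "Card_order bd"
    and bd_infinite: "cinfinite bd"
    and set_bd:
      "\<lbrakk>\<alpha> \<in> type_tuples T; x \<in> carr F \<alpha>\<rbrakk> \<Longrightarrow> |fset F \<alpha> i x| \<le>o bd"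
    and rel_comp:
      "\<lbrakk>\<alpha> \<in> type_tuples T; \<beta> \<in> type_tuples T; \<gamma> \<in> type_tuples T; R \<in> rels \<alpha> \<beta>; S \<in> rels \<beta> \<gamma>\<rbrakk>
       \<Longrightarrow> rel_F F \<alpha> \<beta> R O rel_F F \<beta> \<gamma> S \<subseteq> rel_F F \<alpha> \<gamma> (\<lambda>i. R i O S i)"

definition F_in ::
  "('n, 'a, 'f) functor_ops \<Rightarrow> ('n, 'a) types \<Rightarrow> ('n \<Rightarrow> 'a val set) \<Rightarrow> 'f set" where
  "F_in F \<alpha> A = {x \<in> carr F \<alpha>. \<forall>i. fset F \<alpha> i x \<subseteq> A i}"


section \<open>Polymorphic equivalence relations\<close>

text \<open>
  The class of \<open>x\<close> in a relation \<open>r\<close> is \<^term>\<open>r `` {x}\<close>, and \<^term>\<open>X // r\<close> is the set of classes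
  of elements of \<open>X\<close>, where \<open>X\<close> need not be the whole carrier.
\<close>

type_synonym ('n, 'a, 'f) poly_rel = "('n, 'a) types \<Rightarrow> ('f \<times> 'f) set"

definition poly_equiv ::
  "'a val set set \<Rightarrow> ('n, 'a, 'f) functor_ops \<Rightarrow> ('n, 'a, 'f) poly_rel \<Rightarrow> bool" where
  "poly_equiv T F E \<longleftrightarrow> (\<forall>\<alpha> \<in> type_tuples T. equiv (carr F \<alpha>) (E \<alpha>))"

definition map_compatible ::
  "'a val set set \<Rightarrow> ('n, 'a, 'f) functor_ops \<Rightarrow> ('n, 'a, 'f) poly_rel \<Rightarrow> bool" where
  "map_compatible T F E \<longleftrightarrow>
     (\<forall>\<alpha> \<in> type_tuples T. \<forall>\<beta> \<in> type_tuples T. \<forall>f \<in> funs \<alpha> \<beta>. \<forall>x y.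
        (x, y) \<in> E \<alpha> \<longrightarrow> (fmap F \<alpha> \<beta> f x, fmap F \<alpha> \<beta> f y) \<in> E \<beta>)"

definition WI ::
  "'a val set set \<Rightarrow> ('n, 'a, 'f) functor_ops \<Rightarrow> ('n, 'a, 'f) poly_rel \<Rightarrow> bool" where
  "WI T F E \<longleftrightarrow>
     (\<forall>\<alpha> \<in> type_tuples T. \<forall>\<A> :: 'n \<Rightarrow> 'a val set set.
        (\<forall>i. \<A> i \<subseteq> Pow (\<alpha> i) \<and> \<A> i \<noteq> {} \<and> \<Inter>(\<A> i) \<noteq> {}) \<longrightarrow>
        \<Inter>{F_in F \<alpha> A // E \<alpha> | A. \<forall>i. A i \<in> \<A> i}
          \<subseteq> \<Inter>{F_in F \<alpha> A | A. \<forall>i. A i \<in> \<A> i} // E \<alpha>)"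

definition map_vimage ::
  "('n, 'a, 'f) functor_ops \<Rightarrow> ('n, 'a) types \<Rightarrow> ('n, 'a) types \<Rightarrow>
   ('n \<Rightarrow> 'a val \<Rightarrow> 'a val) \<Rightarrow> 'f set \<Rightarrow> 'f set" where
  "map_vimage F \<alpha> \<beta> f Y = {x \<in> carr F \<alpha>. fmap F \<alpha> \<beta> f x \<in> Y}"

definition PP ::
  "'a val set set \<Rightarrow> ('n, 'a, 'f) functor_ops \<Rightarrow> ('n, 'a, 'f) poly_rel \<Rightarrow> bool" where
  "PP T F E \<longleftrightarrow>
     (\<forall>\<alpha> \<in> type_tuples T. \<forall>\<beta> \<in> type_tuples T. \<forall>f \<in> funs \<alpha> \<beta>. \<forall>A.
        (\<forall>i. A i \<subseteq> \<beta> i \<and> {a \<in> \<alpha> i. f i a \<in> A i} \<noteq> {}) \<longrightarrow>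
        map_vimage F \<alpha> \<beta> f (\<Union>(F_in F \<beta> A // E \<beta>))
          \<subseteq> \<Union>(map_vimage F \<alpha> \<beta> f (F_in F \<beta> A) // E \<alpha>))"


section \<open>The quotient\<close>

abbreviation carr_Q ::
  "('n, 'a, 'f) functor_ops \<Rightarrow> ('n, 'a, 'f) poly_rel \<Rightarrow> ('n, 'a) types \<Rightarrow> 'f set set" where
  "carr_Q F E \<alpha> \<equiv> carr F \<alpha> // E \<alpha>"

text \<open>
  The function on classes induced by \<open>fmap\<close>, in the library's form (see \<open>UN_equiv_class\<close>): for a
  map-compatible family of equivalences all members of the union coincide, so the class of \<open>x\<close> is
  sent to the class of the image of \<open>x\<close>.
\<close>

definition map_Q ::
  "('n, 'a, 'f) functor_ops \<Rightarrow> ('n, 'a, 'f) poly_rel \<Rightarrow> ('n, 'a) types \<Rightarrow> ('n, 'a) types \<Rightarrow>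
   ('n \<Rightarrow> 'a val \<Rightarrow> 'a val) \<Rightarrow> 'f set \<Rightarrow> 'f set" where
  "map_Q F E \<alpha> \<beta> f q = (\<Union>x\<in>q. E \<beta> `` {fmap F \<alpha> \<beta> f x})"

lemma map_Q_class:
  assumes "poly_equiv T F E" "map_compatible T F E"
    and "\<alpha> \<in> type_tuples T" "\<beta> \<in> type_tuples T" "f \<in> funs \<alpha> \<beta>" "x \<in> carr F \<alpha>"
  shows "map_Q F E \<alpha> \<beta> f (E \<alpha> `` {x}) = E \<beta> `` {fmap F \<alpha> \<beta> f x}"
proof -
  have eq: "equiv (carr F \<alpha>) (E \<alpha>)" "equiv (carr F \<beta>) (E \<beta>)"
    using assms by (auto simp: poly_equiv_def)
  have "congruent (E \<alpha>) (\<lambda>x. E \<beta> `` {fmap F \<alpha> \<beta> f x})"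
    using assms by (auto simp: map_compatible_def intro!: congruentI equiv_class_eq[OF eq(2)])
  from UN_equiv_class[OF eq(1) this assms(6)] show ?thesis
    by (simp add: map_Q_def)
qed

definition Q_in ::
  "('n, 'a, 'f) functor_ops \<Rightarrow> ('n, 'a, 'f) poly_rel \<Rightarrow> ('n, 'a) types \<Rightarrow>
   ('n \<Rightarrow> 'a val set) \<Rightarrow> 'f set set" where
  "Q_in F E \<alpha> A =
     {q \<in> carr_Q F E \<alpha>.
        \<forall>f \<in> funs \<alpha> (one_pluses \<alpha>). \<forall>g \<in> funs \<alpha> (one_pluses \<alpha>).
          (\<forall>i. \<forall>a \<in> A i. f i a = g i a) \<longrightarrow>
          map_Q F E \<alpha> (one_pluses \<alpha>) f q = map_Q F E \<alpha> (one_pluses \<alpha>) g q}"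

text \<open>In the tuple \<^term>\<open>\<alpha>(i := A)\<close> the sets \<^term>\<open>\<alpha> j\<close> play the role of \<open>UNIV\<close>.\<close>

definition set_Q ::
  "('n, 'a, 'f) functor_ops \<Rightarrow> ('n, 'a, 'f) poly_rel \<Rightarrow> ('n, 'a) types \<Rightarrow> 'n \<Rightarrow>
   'f set \<Rightarrow> 'a val set" where
  "set_Q F E \<alpha> i q = \<Inter>{A. A \<subseteq> \<alpha> i \<and> q \<in> Q_in F E \<alpha> (\<alpha>(i := A))}"

definition rel_Q ::
  "('n, 'a, 'f) functor_ops \<Rightarrow> ('n, 'a, 'f) poly_rel \<Rightarrow> ('n, 'a) types \<Rightarrow> ('n, 'a) types \<Rightarrow>
   ('n \<Rightarrow> ('a val \<times> 'a val) set) \<Rightarrow> ('f set \<times> 'f set) set" where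
  "rel_Q F E \<alpha> \<beta> R =
     {(q, r). \<exists>p \<in> carr_Q F E (prods \<alpha> \<beta>).
        (\<forall>i. set_Q F E (prods \<alpha> \<beta>) i p \<subseteq> rel_graph (R i)) \<and>
        map_Q F E (prods \<alpha> \<beta>) \<alpha> (\<lambda>_. pfst) p = q \<and>
        map_Q F E (prods \<alpha> \<beta>) \<beta> (\<lambda>_. psnd) p = r}"

end

theory Submission
  imports Defs
begin

text \<open>
  A class \<open>[x]\<close> lies in \<^term>\<open>Q_in F E \<alpha> A\<close> iff the image of \<open>x\<close> under \<^term>\<open>emb\<close> is equivalent to
  an element supported in \<^term>\<open>star\<close> and the embedded sets \<open>A i\<close>: compare \<^term>\<open>emb\<close> with the map
  that collapses everything outside \<open>A i\<close> to \<^term>\<open>star\<close>. Since \<^term>\<open>star\<close> lies in all these supports,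
  (WI) applies without a nonemptiness proviso and shows that \<open>set_Q\<close> is bounded by \<open>B\<close> iff the class
  lies in \<^term>\<open>Q_in F E \<alpha> B\<close>. A witness of \<open>rel_Q\<close> thus yields a witness of \<open>rel_F\<close> by distributing
  \<open>1 +\<close> over the product. Conversely, a witness of \<open>rel_F\<close> is turned into an element over the
  product by replacing \<open>(star, star)\<close> with a default pair. The default can be chosen in \<open>R i\<close> unless
  \<open>R i\<close> is empty; in that case (PP) for the first projection, with the singleton of \<^term>\<open>star\<close> as
  target set, shows that the resulting class does not depend on coordinate \<open>i\<close> at all.
\<close>

section \<open>Maps between \<open>A\<close>, \<open>1 + A\<close> and products\<close>

text \<open>The copairing of the constant \<open>c\<close> with \<open>f\<close> on
  \<open>1 + A\<close>. With the identity for \<open>f\<close> it is a left inverse of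
  \<open>emb\<close>, which is the abbreviation that follows.\<close>

definition lift_star :: "'a val \<Rightarrow> ('a val \<Rightarrow> 'a val) \<Rightarrow> 'a val \<Rightarrow> 'a val" where
  "lift_star c f v = (case v of Inr a \<Rightarrow> f a | _ \<Rightarrow> c)"

abbreviation un_emb :: "'a val \<Rightarrow> 'a val \<Rightarrow> 'a val" where
  "un_emb d \<equiv> lift_star d (\<lambda>a. a)"

text \<open>The canonical map from \<open>1 + (A \<times> B)\<close> to
  \<open>(1 + A) \<times> (1 + B)\<close>.\<close>

definition split_star :: "'a val \<Rightarrow> 'a val" where
  "split_star v = (case v of Inr p \<Rightarrow> Pair (emb (pfst p)) (emb (psnd p)) | _ \<Rightarrow> Pair star star)"

text \<open>Undoes \<open>split_star\<close> on embedded pairs, with \<open>d\<close> standing in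
  for the pair that \<open>star\<close> lacks. Mixed pairs of \<open>star\<close> and an embedded
  value also go to \<open>d\<close>, but none of them belongs to any
  \<open>rel_one_plus R\<close>.\<close>

definition join_emb :: "'a val \<Rightarrow> 'a val \<Rightarrow> 'a val" where
  "join_emb d v = (case v of Pair (Inr a) (Inr b) \<Rightarrow> Pair a b | _ \<Rightarrow> d)"

lemma lift_star_simps [simp]:
  "lift_star c f (emb a) = f a" "lift_star c f (Inl b) = c"
  by (simp_all add: lift_star_def)

lemma split_star_simps [simp]:
  "split_star (emb p) = Pair (emb (pfst p)) (emb (psnd p))"
  "split_star (Inl b) = Pair star star"
  by (simp_all add: split_star_def)

lemma join_emb_simps [simp]:
  "join_emb d (Pair (emb a) (emb b)) = Pair a b"
  "join_emb d (Pair (Inl u) v) = d"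
  by (simp_all add: join_emb_def)

lemma one_plus_eq: "one_plus A = insert star (emb ` A)"
  by (auto simp: one_plus_def sum_ty_def)

lemma join_emb_in:
  "v \<in> prod_ty (one_plus A) (one_plus B) \<Longrightarrow> d \<in> prod_ty A B \<Longrightarrow> join_emb d v \<in> prod_ty A B"
  by (auto simp: prod_ty_def one_plus_eq join_emb_def)

lemma rel_graph_subset:
  assumes "R \<in> rels \<alpha> \<beta>"
  shows "rel_graph (R i) \<subseteq> prod_ty (\<alpha> i) (\<beta> i)"
proof -
  have "R i \<subseteq> \<alpha> i \<times> \<beta> i" using assms by (simp add: rels_def)
  then show ?thesis by (auto simp: rel_graph_def prod_ty_def)
qed

section \<open>Supports in the quotient, coordinate by coordinate\<close>

lemma Q_inD:
  assumes "q \<in> Q_in F E \<alpha> A" "f \<in> funs \<alpha> (one_pluses \<alpha>)" "g \<in> funs \<alpha> (one_pluses \<alpha>)"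
    and "\<And>i a. a \<in> A i \<Longrightarrow> f i a = g i a"
  shows "map_Q F E \<alpha> (one_pluses \<alpha>) f q = map_Q F E \<alpha> (one_pluses \<alpha>) g q"
  using assms unfolding Q_in_def by blast

text \<open>Two tuples agreeing on \<open>A\<close> are connected by changing one coordinate at a time.\<close>

lemma Q_in_coordinates:
  fixes A :: "'n::finite \<Rightarrow> 'a val set"
  assumes "\<And>i. q \<in> Q_in F E \<alpha> (\<alpha>(i := A i))"
  shows "q \<in> Q_in F E \<alpha> A"
proof -
  let ?M = "map_Q F E \<alpha> (one_pluses \<alpha>)"
  have "?M f q = ?M g q"
    if f: "f \<in> funs \<alpha> (one_pluses \<alpha>)" and g: "g \<in> funs \<alpha> (one_pluses \<alpha>)"
      and eq: "\<And>i a. a \<in> A i \<Longrightarrow> f i a = g i a" for f g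
  proof -
    define h where "h I i = (if i \<in> I then g i else f i)" for I i
    have h: "h I \<in> funs \<alpha> (one_pluses \<alpha>)" for I
      using f g by (simp add: h_def funs_def)
    have "?M f q = ?M (h I) q" if "finite I" for I
      using that
    proof induction
      case empty
      have "h {} = f" by (simp add: h_def fun_eq_iff)
      then show ?case by simp
    next
      case (insert j I)
      \<comment> \<open>The two tuples differ at most at \<open>j\<close>, and there they agree on
        \<open>A j\<close>; this is exactly the difference that membership for
        \<open>\<alpha>(j := A j)\<close> permits.\<close>
      have "?M (h I) q = ?M (h (insert j I)) q"
        by (rule Q_inD[OF assms[of j] h h]) (auto simp: h_def eq split: if_splits)
      with insert.IH show ?case by simp
    qed
    from this[OF finite[of UNIV]] show ?thesis by (simp add: h_def[abs_def])
  qed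
  moreover have "q \<in> carr_Q F E \<alpha>"
    using assms[of undefined] by (simp add: Q_in_def)
  ultimately show ?thesis
    unfolding Q_in_def by (intro CollectI conjI ballI impI) blast+
qed

lemma Q_in_mono:
  assumes "q \<in> Q_in F E \<alpha> A" "\<And>i. A i \<subseteq> B i"
  shows "q \<in> Q_in F E \<alpha> B"
  using assms unfolding Q_in_def by blast

section \<open>Basic facts about classes and embeddings\<close>

locale BNF_quotient = BNF T F bd
  for T :: "'a val set set" and F :: "('n::finite, 'a, 'f) functor_ops" and bd :: "'b rel" +
  fixes E :: "('n, 'a, 'f) poly_rel"
  assumes universe: "type_universe T"
    and equivs: "poly_equiv T F E"
    and compat: "map_compatible T F E"
begin

lemma one_pluses_types [simp, intro]:
  "\<alpha> \<in> type_tuples T \<Longrightarrow> one_pluses \<alpha> \<in> type_tuples T"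
  using universe by (auto simp: type_tuples_def type_universe_def)

lemma prods_types [simp, intro]:
  "\<alpha> \<in> type_tuples T \<Longrightarrow> \<beta> \<in> type_tuples T \<Longrightarrow> prods \<alpha> \<beta> \<in> type_tuples T"
  using universe by (auto simp: type_tuples_def type_universe_def)

lemma type_nonempty: "\<alpha> \<in> type_tuples T \<Longrightarrow> \<alpha> i \<noteq> {}"
  using universe by (auto simp: type_tuples_def type_universe_def)

lemma E_equiv: "\<alpha> \<in> type_tuples T \<Longrightarrow> equiv (carr F \<alpha>) (E \<alpha>)"
  using equivs by (auto simp: poly_equiv_def)

lemma E_refl: "\<alpha> \<in> type_tuples T \<Longrightarrow> x \<in> carr F \<alpha> \<Longrightarrow> (x, x) \<in> E \<alpha>"
  using E_equiv by (metis equivE refl_onD)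

lemma E_sym: "\<alpha> \<in> type_tuples T \<Longrightarrow> (x, y) \<in> E \<alpha> \<Longrightarrow> (y, x) \<in> E \<alpha>"
  using E_equiv by (metis equivE symD)

lemma E_trans:
  "\<alpha> \<in> type_tuples T \<Longrightarrow> (x, y) \<in> E \<alpha> \<Longrightarrow> (y, z) \<in> E \<alpha> \<Longrightarrow> (x, z) \<in> E \<alpha>"
  using E_equiv by (metis equivE transD)

lemma E_carr:
  assumes "\<alpha> \<in> type_tuples T" "(x, y) \<in> E \<alpha>"
  shows "x \<in> carr F \<alpha>" "y \<in> carr F \<alpha>"
  using equiv_type[OF E_equiv[OF assms(1)]] assms(2) by auto

lemma E_map:
  "\<lbrakk>\<alpha> \<in> type_tuples T; \<beta> \<in> type_tuples T; f \<in> funs \<alpha> \<beta>; (x, y) \<in> E \<alpha>\<rbrakk>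
   \<Longrightarrow> (fmap F \<alpha> \<beta> f x, fmap F \<alpha> \<beta> f y) \<in> E \<beta>"
  using compat by (auto simp: map_compatible_def)

text \<open>Translates between (WI), which speaks of sets of classes, and elements. As
  \<open>X\<close> may be a proper part of the carrier, what counts is that some member of the class
  lies in \<open>X\<close>.\<close>

lemma class_in_quotient_iff:
  assumes "\<alpha> \<in> type_tuples T" "x \<in> carr F \<alpha>" "X \<subseteq> carr F \<alpha>"
  shows "E \<alpha> `` {x} \<in> X // E \<alpha> \<longleftrightarrow> (\<exists>u\<in>X. (x, u) \<in> E \<alpha>)"
proof -
  have "E \<alpha> `` {x} = E \<alpha> `` {u} \<longleftrightarrow> (x, u) \<in> E \<alpha>" if "u \<in> X" for u
    using assms that by (intro eq_equiv_class_iff[OF E_equiv]) auto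
  then show ?thesis by (auto simp: quotient_def)
qed

lemma map_Q_eq_iff:
  assumes "\<alpha> \<in> type_tuples T" "\<beta> \<in> type_tuples T" "f \<in> funs \<alpha> \<beta>" "x \<in> carr F \<alpha>" "y \<in> carr F \<beta>"
  shows "map_Q F E \<alpha> \<beta> f (E \<alpha> `` {x}) = E \<beta> `` {y} \<longleftrightarrow> (fmap F \<alpha> \<beta> f x, y) \<in> E \<beta>"
  unfolding map_Q_class[OF equivs compat assms(1-4)]
  using assms eq_equiv_class_iff[OF E_equiv[OF assms(2)] map_closed[OF assms(1-4)] assms(5)]
  by blast

lemma emb_funs [simp]: "(\<lambda>_. emb) \<in> funs \<alpha> (one_pluses \<alpha>)"
  by (auto simp: funs_def one_plus_eq)

lemma pfst_funs [simp]: "(\<lambda>_. pfst) \<in> funs (prods \<alpha> \<beta>) \<alpha>"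
  by (auto simp: funs_def prod_ty_def)

lemma psnd_funs [simp]: "(\<lambda>_. psnd) \<in> funs (prods \<alpha> \<beta>) \<beta>"
  by (auto simp: funs_def prod_ty_def)

lemma un_emb_funs: "(\<And>i. d i \<in> \<alpha> i) \<Longrightarrow> (\<lambda>i. un_emb (d i)) \<in> funs (one_pluses \<alpha>) \<alpha>"
  by (auto simp: funs_def one_plus_eq)

text \<open>Because \<open>un_emb (d i)\<close> is a left inverse of \<open>emb\<close>, an
  equivalence between embedded elements can be carried back to \<open>\<alpha>\<close> along
  it.\<close>

lemma map_un_emb_emb:
  assumes "\<alpha> \<in> type_tuples T" "x \<in> carr F \<alpha>" "\<And>i. d i \<in> \<alpha> i"
  shows "fmap F (one_pluses \<alpha>) \<alpha> (\<lambda>i. un_emb (d i)) (fmap F \<alpha> (one_pluses \<alpha>) (\<lambda>_. emb) x) = x"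
proof -
  have "(\<lambda>i. un_emb (d i) \<circ> emb) = (\<lambda>_. id)" by (auto simp: fun_eq_iff)
  then show ?thesis
    using assms by (subst map_comp) (auto simp: un_emb_funs map_id)
qed

section \<open>Supports of classes through the embedding into \<open>1 + \<alpha>\<close>\<close>

text \<open>For the converse, each \<open>f\<close> into \<open>1 + \<alpha>\<close> factors through
  \<open>emb\<close> via its extension by \<open>star\<close>. Up to equivalence its effect on
  \<open>x\<close> is therefore that of the extension on \<open>u\<close>, and the support of
  \<open>u\<close> only sees the values of \<open>f\<close> on \<open>A\<close>.\<close>

lemma Q_in_iff:
  assumes \<alpha>: "\<alpha> \<in> type_tuples T" and x: "x \<in> carr F \<alpha>"
  shows "E \<alpha> `` {x} \<in> Q_in F E \<alpha> A \<longleftrightarrow>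
    (\<exists>u \<in> F_in F (one_pluses \<alpha>) (\<lambda>i. insert star (emb ` A i)).
      (fmap F \<alpha> (one_pluses \<alpha>) (\<lambda>_. emb) x, u) \<in> E (one_pluses \<alpha>))"
    (is "_ \<longleftrightarrow> (\<exists>u \<in> ?X. (?x, u) \<in> _)")
proof
  let ?\<alpha> = "one_pluses \<alpha>"
  note \<alpha>' = one_pluses_types[OF \<alpha>]
  assume q: "E \<alpha> `` {x} \<in> Q_in F E \<alpha> A"
  \<comment> \<open>The collapsing map agrees with \<open>emb\<close> on \<open>A\<close>, so the
    image of \<open>x\<close> under it can serve as \<open>u\<close>.\<close>
  let ?g = "\<lambda>i a. if a \<in> A i then emb a else star"
  have g: "?g \<in> funs \<alpha> ?\<alpha>"
    by (auto simp: funs_def one_plus_eq)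
  have "map_Q F E \<alpha> ?\<alpha> (\<lambda>_. emb) (E \<alpha> `` {x}) = map_Q F E \<alpha> ?\<alpha> ?g (E \<alpha> `` {x})"
    by (rule Q_inD[OF q emb_funs g]) simp
  also have "\<dots> = E ?\<alpha> `` {fmap F \<alpha> ?\<alpha> ?g x}"
    by (rule map_Q_class[OF equivs compat \<alpha> \<alpha>' g x])
  finally have "(?x, fmap F \<alpha> ?\<alpha> ?g x) \<in> E ?\<alpha>"
    using map_Q_eq_iff[OF \<alpha> \<alpha>' emb_funs x map_closed[OF \<alpha> \<alpha>' g x]] by simp
  moreover have "fmap F \<alpha> ?\<alpha> ?g x \<in> ?X"
    using map_closed[OF \<alpha> \<alpha>' g x] by (auto simp: F_in_def set_map[OF \<alpha> \<alpha>' g x])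
  ultimately show "\<exists>u \<in> ?X. (?x, u) \<in> E ?\<alpha>" by blast
next
  let ?\<alpha> = "one_pluses \<alpha>"
  note \<alpha>' = one_pluses_types[OF \<alpha>]
  assume "\<exists>u \<in> ?X. (?x, u) \<in> E ?\<alpha>"
  then obtain u where u: "u \<in> carr F ?\<alpha>" "\<And>i. fset F ?\<alpha> i u \<subseteq> insert star (emb ` A i)"
    and xu: "(?x, u) \<in> E ?\<alpha>"
    by (auto simp: F_in_def)
  have lift: "(\<lambda>i. lift_star star (f i)) \<in> funs ?\<alpha> ?\<alpha>" if "f \<in> funs \<alpha> ?\<alpha>" for f
    using that by (fastforce simp: funs_def one_plus_eq)
  have via_u: "(fmap F \<alpha> ?\<alpha> f x, fmap F ?\<alpha> ?\<alpha> (\<lambda>i. lift_star star (f i)) u) \<in> E ?\<alpha>"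
    if f: "f \<in> funs \<alpha> ?\<alpha>" for f
  proof -
    have "(\<lambda>i. lift_star star (f i) \<circ> emb) = f" by (auto simp: fun_eq_iff)
    then have "fmap F ?\<alpha> ?\<alpha> (\<lambda>i. lift_star star (f i)) ?x = fmap F \<alpha> ?\<alpha> f x"
      using map_comp[OF \<alpha> \<alpha>' \<alpha>' emb_funs lift[OF f] x] by simp
    then show ?thesis using E_map[OF \<alpha>' \<alpha>' lift[OF f] xu] by simp
  qed
  have "map_Q F E \<alpha> ?\<alpha> f (E \<alpha> `` {x}) = map_Q F E \<alpha> ?\<alpha> g (E \<alpha> `` {x})"
    if f: "f \<in> funs \<alpha> ?\<alpha>" and g: "g \<in> funs \<alpha> ?\<alpha>" and eq: "\<forall>i. \<forall>a \<in> A i. f i a = g i a" for f g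
  proof -
    \<comment> \<open>Both extensions fix \<open>star\<close>, and every other value in the support
      of \<open>u\<close> is \<open>emb a\<close> with \<open>a\<close> in
      \<open>A i\<close>.\<close>
    have "\<forall>i. \<forall>v \<in> fset F ?\<alpha> i u. lift_star star (f i) v = lift_star star (g i) v"
    proof (intro allI ballI)
      fix i v assume "v \<in> fset F ?\<alpha> i u"
      with u(2)[of i] eq show "lift_star star (f i) v = lift_star star (g i) v" by auto
    qed
    then have "fmap F ?\<alpha> ?\<alpha> (\<lambda>i. lift_star star (f i)) u
      = fmap F ?\<alpha> ?\<alpha> (\<lambda>i. lift_star star (g i)) u"
      by (intro map_cong \<alpha>' lift f g u)
    with via_u[OF f] via_u[OF g] have "(fmap F \<alpha> ?\<alpha> f x, fmap F \<alpha> ?\<alpha> g x) \<in> E ?\<alpha>"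
      using E_trans[OF \<alpha>'] E_sym[OF \<alpha>'] by metis
    then show ?thesis
      using map_Q_eq_iff[OF \<alpha> \<alpha>' f x map_closed[OF \<alpha> \<alpha>' g x]]
        map_Q_class[OF equivs compat \<alpha> \<alpha>' g x] by simp
  qed
  with quotientI[OF x, of "E \<alpha>"] show "E \<alpha> `` {x} \<in> Q_in F E \<alpha> A"
    unfolding Q_in_def by blast
qed

text \<open>The embedded \<open>x\<close> is its own witness \<open>u\<close> in
  \<open>Q_in_iff\<close>.\<close>

lemma F_in_class_in_Q_in:
  assumes \<alpha>: "\<alpha> \<in> type_tuples T" and x: "x \<in> F_in F \<alpha> A"
  shows "E \<alpha> `` {x} \<in> Q_in F E \<alpha> A"
proof -
  have xc: "x \<in> carr F \<alpha>" using x by (simp add: F_in_def)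
  note emb = one_pluses_types[OF \<alpha>] emb_funs xc
  have "fmap F \<alpha> (one_pluses \<alpha>) (\<lambda>_. emb) x \<in> F_in F (one_pluses \<alpha>) (\<lambda>i. insert star (emb ` A i))"
    using x map_closed[OF \<alpha> emb] by (auto simp: F_in_def set_map[OF \<alpha> emb])
  then show ?thesis
    unfolding Q_in_iff[OF \<alpha> xc] using E_refl[OF emb(1) map_closed[OF \<alpha> emb]] by blast
qed

text \<open>From right to left, \<open>B i\<close> is one of the sets whose intersection is
  \<open>set_Q\<close>. From left to right, (WI) provides one representative that obeys all
  admissible supports at once, hence also their intersection.\<close>

lemma set_Q_subset_iff:
  assumes wi: "WI T F E" and \<alpha>: "\<alpha> \<in> type_tuples T" and x: "x \<in> carr F \<alpha>"
    and B: "\<And>i. B i \<subseteq> \<alpha> i"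
  shows "(\<forall>i. set_Q F E \<alpha> i (E \<alpha> `` {x}) \<subseteq> B i) \<longleftrightarrow> E \<alpha> `` {x} \<in> Q_in F E \<alpha> B"
    (is "_ \<longleftrightarrow> ?q \<in> _")
proof
  assume "?q \<in> Q_in F E \<alpha> B"
  then have "?q \<in> Q_in F E \<alpha> (\<alpha>(i := B i))" for i
    by (rule Q_in_mono) (simp add: B)
  with B show "\<forall>i. set_Q F E \<alpha> i ?q \<subseteq> B i"
    by (auto simp: set_Q_def)
next
  let ?\<alpha> = "one_pluses \<alpha>"
  let ?x = "fmap F \<alpha> ?\<alpha> (\<lambda>_. emb) x"
  note \<alpha>' = one_pluses_types[OF \<alpha>]
  assume sub: "\<forall>i. set_Q F E \<alpha> i ?q \<subseteq> B i"
  have x': "?x \<in> carr F ?\<alpha>" by (rule map_closed[OF \<alpha> \<alpha>' emb_funs x])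
  define S where "S i = {A. A \<subseteq> \<alpha> i \<and> ?q \<in> Q_in F E \<alpha> (\<alpha>(i := A))}" for i
  \<comment> \<open>Adding \<open>star\<close> to every support makes the intersection of each
    family nonempty, as (WI) demands.\<close>
  define \<A> where "\<A> i = (\<lambda>A. insert star (emb ` A)) ` S i" for i
  have "?q \<in> Q_in F E \<alpha> \<alpha>"
    using x set_closed[OF \<alpha> x] by (intro F_in_class_in_Q_in \<alpha>) (simp add: F_in_def)
  \<comment> \<open>The full type is always an admissible support, so no family is empty.\<close>
  then have \<alpha>S: "\<alpha> i \<in> S i" for i by (simp add: S_def)
  have "E ?\<alpha> `` {?x} \<in> F_in F ?\<alpha> A' // E ?\<alpha>" if A': "\<forall>i. A' i \<in> \<A> i" for A'
  proof -
    have "\<exists>A. A \<in> S i \<and> A' i = insert star (emb ` A)" for i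
      using A'[rule_format, of i] by (auto simp: \<A>_def)
    then obtain A where A: "\<And>i. A i \<in> S i" "\<And>i. A' i = insert star (emb ` A i)"
      by metis
    \<comment> \<open>Supports chosen independently for the single coordinates combine to a support
      of the whole tuple.\<close>
    have "?q \<in> Q_in F E \<alpha> A"
      by (rule Q_in_coordinates) (use A(1) in \<open>simp add: S_def\<close>)
    moreover have "A' = (\<lambda>i. insert star (emb ` A i))" using A(2) by blast
    ultimately show ?thesis
      using Q_in_iff[OF \<alpha> x]
      by (subst class_in_quotient_iff[OF \<alpha>' x']) (auto simp: F_in_def)
  qed
  then have "E ?\<alpha> `` {?x} \<in> \<Inter>{F_in F ?\<alpha> A' // E ?\<alpha> | A'. \<forall>i. A' i \<in> \<A> i}" by blast
  moreover have "\<A> i \<subseteq> Pow (?\<alpha> i) \<and> \<A> i \<noteq> {} \<and> \<Inter>(\<A> i) \<noteq> {}" for i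
  proof (intro conjI)
    show "\<A> i \<subseteq> Pow (?\<alpha> i)"
      unfolding \<A>_def S_def one_plus_eq by blast
    show "\<A> i \<noteq> {}"
      unfolding \<A>_def using \<alpha>S[of i] by blast
    have "star \<in> \<Inter>(\<A> i)"
      unfolding \<A>_def by blast
    then show "\<Inter>(\<A> i) \<noteq> {}" by blast
  qed
  ultimately have in_quot: "E ?\<alpha> `` {?x} \<in> \<Inter>{F_in F ?\<alpha> A' | A'. \<forall>i. A' i \<in> \<A> i} // E ?\<alpha>"
    using wi[unfolded WI_def, rule_format, OF \<alpha>', of \<A>] by (meson subsetD)
  have \<A>_types: "insert star (emb ` \<alpha> i) \<in> \<A> i" for i
    using \<alpha>S by (auto simp: \<A>_def)
  \<comment> \<open>The intersection must lie in the carrier before its classes can be read as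
    equivalences with elements; the choice of full types in all coordinates bounds it.\<close>
  have "\<Inter>{F_in F ?\<alpha> A' | A'. \<forall>i. A' i \<in> \<A> i} \<subseteq> F_in F ?\<alpha> (\<lambda>i. insert star (emb ` \<alpha> i))"
    using \<A>_types by (intro Inter_lower) blast
  then have "\<Inter>{F_in F ?\<alpha> A' | A'. \<forall>i. A' i \<in> \<A> i} \<subseteq> carr F ?\<alpha>"
    by (rule order_trans) (simp add: F_in_def)
  from in_quot[unfolded class_in_quotient_iff[OF \<alpha>' x' this]]
  obtain u where xu: "(?x, u) \<in> E ?\<alpha>"
    and "u \<in> \<Inter>{F_in F ?\<alpha> A' | A'. \<forall>i. A' i \<in> \<A> i}" by (elim bexE)
  then have u: "u \<in> F_in F ?\<alpha> A'" if "\<forall>i. A' i \<in> \<A> i" for A'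
    using that by blast
  have "fset F ?\<alpha> i u \<subseteq> insert star (emb ` B i)" for i
  proof
    fix v assume v: "v \<in> fset F ?\<alpha> i u"
    have in_A: "v \<in> insert star (emb ` A)" if "A \<in> S i" for A
    proof -
      \<comment> \<open>Full types outside \<open>i\<close> isolate the constraint that
        \<open>A\<close> imposes at \<open>i\<close>.\<close>
      let ?A' = "(\<lambda>i. insert star (emb ` \<alpha> i))(i := insert star (emb ` A))"
      have "\<forall>i. ?A' i \<in> \<A> i" using \<A>_types that by (auto simp: \<A>_def)
      from u[OF this] have "fset F ?\<alpha> i u \<subseteq> ?A' i" by (simp only: F_in_def mem_Collect_eq)
      with v show ?thesis by auto
    qed
    show "v \<in> insert star (emb ` B i)"
    proof (cases "v = star")
      case False
      \<comment> \<open>The full type shows that \<open>v\<close> is an embedded value; its preimage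
        then lies in every admissible support, so in \<open>set_Q\<close>.\<close>
      with in_A[OF \<alpha>S] obtain a where "v = emb a" by auto
      with in_A have "a \<in> set_Q F E \<alpha> i ?q" by (auto simp: set_Q_def S_def)
      with sub \<open>v = emb a\<close> show ?thesis by auto
    qed simp
  qed
  then show "?q \<in> Q_in F E \<alpha> B"
    unfolding Q_in_iff[OF \<alpha> x] using xu E_carr(2)[OF \<alpha>' xu] by (auto simp: F_in_def)
qed

section \<open>From the relator of the quotient to the relator of \<open>F\<close>\<close>

lemma split_star_funs:
  "(\<lambda>_. split_star) \<in> funs (one_pluses (prods \<alpha> \<beta>)) (prods (one_pluses \<alpha>) (one_pluses \<beta>))"
  by (auto simp: funs_def one_plus_eq prod_ty_def)

lemma rel_Q_imp_rel_F:
  assumes wi: "WI T F E" and \<alpha>: "\<alpha> \<in> type_tuples T" and \<beta>: "\<beta> \<in> type_tuples T"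
    and R: "R \<in> rels \<alpha> \<beta>" and x: "x \<in> carr F \<alpha>" and y: "y \<in> carr F \<beta>"
    and rel: "(E \<alpha> `` {x}, E \<beta> `` {y}) \<in> rel_Q F E \<alpha> \<beta> R"
  shows "(fmap F \<alpha> (one_pluses \<alpha>) (\<lambda>_. emb) x, fmap F \<beta> (one_pluses \<beta>) (\<lambda>_. emb) y)
      \<in> E (one_pluses \<alpha>)
          O rel_F F (one_pluses \<alpha>) (one_pluses \<beta>) (\<lambda>i. rel_one_plus (R i))
          O E (one_pluses \<beta>)"
proof -
  let ?\<alpha> = "one_pluses \<alpha>" and ?\<beta> = "one_pluses \<beta>"
  let ?\<gamma> = "prods \<alpha> \<beta>"
  let ?\<gamma>1 = "one_pluses ?\<gamma>" and ?\<gamma>2 = "prods ?\<alpha> ?\<beta>"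
  note types = \<alpha> \<beta> one_pluses_types[OF \<alpha>] one_pluses_types[OF \<beta>] prods_types[OF \<alpha> \<beta>]
  have \<gamma>1: "?\<gamma>1 \<in> type_tuples T" and \<gamma>2: "?\<gamma>2 \<in> type_tuples T"
    by (intro one_pluses_types prods_types types)+
  note RB = rel_graph_subset[OF R]
  from rel obtain z where z: "z \<in> carr F ?\<gamma>"
    and zR: "\<forall>i. set_Q F E ?\<gamma> i (E ?\<gamma> `` {z}) \<subseteq> rel_graph (R i)"
    and zx: "(fmap F ?\<gamma> \<alpha> (\<lambda>_. pfst) z, x) \<in> E \<alpha>"
    and zy: "(fmap F ?\<gamma> \<beta> (\<lambda>_. psnd) z, y) \<in> E \<beta>"
    by (auto simp: rel_Q_def x y types map_Q_eq_iff elim!: quotientE)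
  from zR have "E ?\<gamma> `` {z} \<in> Q_in F E ?\<gamma> (\<lambda>i. rel_graph (R i))"
    by (subst (asm) set_Q_subset_iff[OF wi types(5) z RB])
  then obtain u where u: "u \<in> carr F ?\<gamma>1"
      "\<And>i. fset F ?\<gamma>1 i u \<subseteq> insert star (emb ` rel_graph (R i))"
    and zu: "(fmap F ?\<gamma> ?\<gamma>1 (\<lambda>_. emb) z, u) \<in> E ?\<gamma>1"
    unfolding Q_in_iff[OF types(5) z] by (auto simp: F_in_def)
  \<comment> \<open>The witness for \<open>rel_F\<close>: under \<open>split_star\<close>,
    \<open>star\<close> becomes the pair of two \<open>star\<close> and an embedded pair from
    \<open>R i\<close> becomes a pair of embedded components, which are the two clauses of
    \<open>rel_one_plus\<close>.\<close>
  let ?w = "fmap F ?\<gamma>1 ?\<gamma>2 (\<lambda>_. split_star) u"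
  have w: "?w \<in> carr F ?\<gamma>2"
    by (rule map_closed[OF \<gamma>1 \<gamma>2 split_star_funs u(1)])
  have "fset F ?\<gamma>2 i ?w \<subseteq> rel_graph (rel_one_plus (R i))" for i
    using u(2)[of i] unfolding set_map[OF \<gamma>1 \<gamma>2 split_star_funs u(1)]
    by (force simp: rel_graph_def rel_one_plus_def)
  with w have rel_w: "(fmap F ?\<gamma>2 ?\<alpha> (\<lambda>_. pfst) ?w, fmap F ?\<gamma>2 ?\<beta> (\<lambda>_. psnd) ?w)
      \<in> rel_F F ?\<alpha> ?\<beta> (\<lambda>i. rel_one_plus (R i))"
    by (auto simp: rel_F_def)
  \<comment> \<open>Both projections at once. As \<open>\<pi>\<close> after
    \<open>split_star\<close> after \<open>emb\<close> is \<open>emb\<close> after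
    \<open>\<pi>\<close>, the equivalence of the embedded \<open>z\<close> with \<open>u\<close> and
    that of the projected \<open>z\<close> with \<open>t\<close> meet in one element.\<close>
  have proj: "(fmap F \<delta> (one_pluses \<delta>) (\<lambda>_. emb) t, fmap F ?\<gamma>2 (one_pluses \<delta>) (\<lambda>_. \<pi>) ?w)
      \<in> E (one_pluses \<delta>)"
    if \<delta>: "\<delta> \<in> type_tuples T" and \<pi>: "(\<lambda>_. \<pi>) \<in> funs ?\<gamma> \<delta>" "(\<lambda>_. \<pi>) \<in> funs ?\<gamma>2 (one_pluses \<delta>)"
      and comm: "\<And>p. \<pi> (split_star (emb p)) = emb (\<pi> p)"
      and zt: "(fmap F ?\<gamma> \<delta> (\<lambda>_. \<pi>) z, t) \<in> E \<delta>" for \<delta> \<pi> t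
  proof -
    note \<delta>' = one_pluses_types[OF \<delta>]
    let ?h = "fmap F ?\<gamma>2 (one_pluses \<delta>) (\<lambda>_. \<pi>)"
    let ?s = "fmap F ?\<gamma>1 ?\<gamma>2 (\<lambda>_. split_star)"
    let ?ez = "fmap F ?\<gamma> ?\<gamma>1 (\<lambda>_. emb) z"
    have split_emb: "(\<lambda>i::'n. split_star \<circ> emb) \<in> funs ?\<gamma> ?\<gamma>2"
      by (auto simp: funs_def prod_ty_def one_plus_eq)
    have "?h (?s ?ez) = fmap F ?\<gamma> (one_pluses \<delta>) (\<lambda>_. \<pi> \<circ> (split_star \<circ> emb)) z"
      using map_comp[OF types(5) \<gamma>1 \<gamma>2 emb_funs split_star_funs z]
        map_comp[OF types(5) \<gamma>2 \<delta>' split_emb \<pi>(2) z] by simp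
    also have "(\<lambda>i::'n. \<pi> \<circ> (split_star \<circ> emb)) = (\<lambda>_. emb \<circ> \<pi>)"
      using comm by (auto simp: fun_eq_iff)
    also have "fmap F ?\<gamma> (one_pluses \<delta>) (\<lambda>_. emb \<circ> \<pi>) z
        = fmap F \<delta> (one_pluses \<delta>) (\<lambda>_. emb) (fmap F ?\<gamma> \<delta> (\<lambda>_. \<pi>) z)"
      using map_comp[OF types(5) \<delta> \<delta>' \<pi>(1) emb_funs z] by simp
    finally have eq: "?h (?s ?ez) = \<dots>" .
    have "(?h (?s ?ez), fmap F \<delta> (one_pluses \<delta>) (\<lambda>_. emb) t) \<in> E (one_pluses \<delta>)"
      unfolding eq by (rule E_map[OF \<delta> \<delta>' emb_funs zt])
    moreover have "(?h (?s ?ez), ?h ?w) \<in> E (one_pluses \<delta>)"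
      by (intro E_map[OF \<gamma>2 \<delta>' \<pi>(2)] E_map[OF \<gamma>1 \<gamma>2 split_star_funs] zu)
    ultimately show ?thesis by (rule E_trans[OF \<delta>' E_sym[OF \<delta>']])
  qed
  show ?thesis
    using proj[OF \<alpha> pfst_funs pfst_funs _ zx] proj[OF \<beta> psnd_funs psnd_funs _ zy] rel_w
      E_sym[OF types(4)] by auto
qed

section \<open>From the relator of \<open>F\<close> to the relator of the quotient\<close>

lemma rel_F_imp_rel_Q:
  assumes wi: "WI T F E" and pp: "PP T F E"
    and \<alpha>: "\<alpha> \<in> type_tuples T" and \<beta>: "\<beta> \<in> type_tuples T"
    and R: "R \<in> rels \<alpha> \<beta>" and x: "x \<in> carr F \<alpha>" and y: "y \<in> carr F \<beta>"
    and rel: "(fmap F \<alpha> (one_pluses \<alpha>) (\<lambda>_. emb) x, fmap F \<beta> (one_pluses \<beta>) (\<lambda>_. emb) y)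
      \<in> E (one_pluses \<alpha>)
          O rel_F F (one_pluses \<alpha>) (one_pluses \<beta>) (\<lambda>i. rel_one_plus (R i))
          O E (one_pluses \<beta>)"
  shows "(E \<alpha> `` {x}, E \<beta> `` {y}) \<in> rel_Q F E \<alpha> \<beta> R"
proof -
  let ?\<alpha> = "one_pluses \<alpha>" and ?\<beta> = "one_pluses \<beta>"
  let ?\<gamma> = "prods \<alpha> \<beta>"
  let ?\<gamma>1 = "one_pluses ?\<gamma>" and ?\<gamma>2 = "prods ?\<alpha> ?\<beta>"
  note types = \<alpha> \<beta> one_pluses_types[OF \<alpha>] one_pluses_types[OF \<beta>] prods_types[OF \<alpha> \<beta>]
  have \<gamma>1: "?\<gamma>1 \<in> type_tuples T" and \<gamma>2: "?\<gamma>2 \<in> type_tuples T"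
    by (intro one_pluses_types prods_types types)+
  note RB = rel_graph_subset[OF R]
  from rel obtain w where w: "w \<in> carr F ?\<gamma>2"
    and wR: "\<And>i. fset F ?\<gamma>2 i w \<subseteq> rel_graph (rel_one_plus (R i))"
    and xw: "(fmap F \<alpha> ?\<alpha> (\<lambda>_. emb) x, fmap F ?\<gamma>2 ?\<alpha> (\<lambda>_. pfst) w) \<in> E ?\<alpha>"
    and wy: "(fmap F ?\<gamma>2 ?\<beta> (\<lambda>_. psnd) w, fmap F \<beta> ?\<beta> (\<lambda>_. emb) y) \<in> E ?\<beta>"
    by (auto simp: rel_F_def)
  have "\<exists>d. d \<in> ?\<gamma> i \<and> (R i \<noteq> {} \<longrightarrow> d \<in> rel_graph (R i))" for i
  proof (cases "R i = {}")
    case True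
    then show ?thesis using type_nonempty[OF types(5), of i] by auto
  next
    case False
    then have "rel_graph (R i) \<noteq> {}" by (auto simp: rel_graph_def)
    then show ?thesis using RB by blast
  qed
  then obtain d where d: "\<And>i. d i \<in> ?\<gamma> i" "\<And>i. R i \<noteq> {} \<Longrightarrow> d i \<in> rel_graph (R i)"
    by metis
  let ?j = "\<lambda>i. join_emb (d i)"
  \<comment> \<open>The candidate for the \<open>rel_Q\<close> witness. Its projections come out
    right for any default in the product; the choice inside \<open>R i\<close> matters only for the
    support.\<close>
  let ?z = "fmap F ?\<gamma>2 ?\<gamma> ?j w"
  have j: "?j \<in> funs ?\<gamma>2 ?\<gamma>"
    using d(1) join_emb_in by (fastforce simp: funs_def)
  have z: "?z \<in> carr F ?\<gamma>" by (rule map_closed[OF \<gamma>2 types(5) j w])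
  have proj: "(fmap F ?\<gamma> \<delta> (\<lambda>_. \<pi>) ?z, t) \<in> E \<delta>"
    if \<delta>: "\<delta> \<in> type_tuples T" and \<pi>: "(\<lambda>_. \<pi>) \<in> funs ?\<gamma> \<delta>" "(\<lambda>_. \<pi>) \<in> funs ?\<gamma>2 (one_pluses \<delta>)"
      and comm: "\<pi> (Pair star star) = star" "\<And>a b. \<pi> (Pair (emb a) (emb b)) = emb (\<pi> (Pair a b))"
      and wt: "(fmap F ?\<gamma>2 (one_pluses \<delta>) (\<lambda>_. \<pi>) w, fmap F \<delta> (one_pluses \<delta>) (\<lambda>_. emb) t)
        \<in> E (one_pluses \<delta>)"
      and t: "t \<in> carr F \<delta>" for \<delta> \<pi> t
  proof -
    note \<delta>' = one_pluses_types[OF \<delta>]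
    have \<pi>d: "\<pi> (d i) \<in> \<delta> i" for i
      using d(1)[of i] \<pi>(1) by (auto simp: funs_def)
    let ?un = "\<lambda>i. un_emb (\<pi> (d i))"
    note un = un_emb_funs[of "\<lambda>i. \<pi> (d i)", OF \<pi>d]
    have "fmap F ?\<gamma> \<delta> (\<lambda>_. \<pi>) ?z = fmap F ?\<gamma>2 \<delta> (\<lambda>i. \<pi> \<circ> ?j i) w"
      by (rule map_comp[OF \<gamma>2 types(5) \<delta> j \<pi>(1) w])
    \<comment> \<open>The two maps need to agree only on the support of \<open>w\<close>, where
      \<open>wR\<close> leaves the pair of two \<open>star\<close> and pairs of embedded values.
      Projecting \<open>d i\<close> thus becomes a default for the projected type.\<close>
    also have "\<dots> = fmap F ?\<gamma>2 \<delta> (\<lambda>i. ?un i \<circ> \<pi>) w"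
    proof (rule map_cong[OF \<gamma>2 \<delta> _ _ w])
      show "(\<lambda>i. \<pi> \<circ> ?j i) \<in> funs ?\<gamma>2 \<delta>" using j \<pi>(1) by (fastforce simp: funs_def)
      show "(\<lambda>i. ?un i \<circ> \<pi>) \<in> funs ?\<gamma>2 \<delta>" using un \<pi>(2) by (fastforce simp: funs_def)
      show "\<forall>i. \<forall>v \<in> fset F ?\<gamma>2 i w. (\<pi> \<circ> ?j i) v = (?un i \<circ> \<pi>) v"
      proof (intro allI ballI)
        fix i v assume "v \<in> fset F ?\<gamma>2 i w"
        with wR[of i] show "(\<pi> \<circ> ?j i) v = (?un i \<circ> \<pi>) v"
          by (auto simp: rel_graph_def rel_one_plus_def comm)
      qed
    qed
    also have "\<dots> = fmap F (one_pluses \<delta>) \<delta> ?un (fmap F ?\<gamma>2 (one_pluses \<delta>) (\<lambda>_. \<pi>) w)"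
      by (rule map_comp[OF \<gamma>2 \<delta>' \<delta> \<pi>(2) un w, symmetric])
    finally show ?thesis
      using E_map[OF \<delta>' \<delta> un wt] map_un_emb_emb[of \<delta> t "\<lambda>i. \<pi> (d i)", OF \<delta> t \<pi>d] by simp
  qed
  have zx: "(fmap F ?\<gamma> \<alpha> (\<lambda>_. pfst) ?z, x) \<in> E \<alpha>"
    by (rule proj[OF \<alpha> pfst_funs pfst_funs _ _ E_sym[OF types(3) xw] x]) simp_all
  have zy: "(fmap F ?\<gamma> \<beta> (\<lambda>_. psnd) ?z, y) \<in> E \<beta>"
    by (rule proj[OF \<beta> psnd_funs psnd_funs _ _ wy y]) simp_all
  have "E ?\<gamma> `` {?z} \<in> Q_in F E ?\<gamma> (?\<gamma>(i := rel_graph (R i)))" for i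
  proof (cases "R i = {}")
    case False
    \<comment> \<open>Pairs of embedded values come from \<open>R i\<close>, and the default was
      chosen in \<open>R i\<close> as well.\<close>
    have "fset F ?\<gamma> i ?z \<subseteq> rel_graph (R i)"
      using wR[of i] d(2)[OF False] unfolding set_map[OF \<gamma>2 types(5) j w]
      by (force simp: rel_graph_def rel_one_plus_def)
    then show ?thesis
      using z set_closed[OF types(5) z] by (intro F_in_class_in_Q_in types) (auto simp: F_in_def)
  next
    case True
    \<comment> \<open>This is \<open>1 + pfst\<close> in every coordinate. The target set is the
      singleton of \<open>star\<close> at \<open>i\<close> and the full type elsewhere, so all its
      preimages contain \<open>star\<close>.\<close>
    let ?f = "\<lambda>_::'n. lift_star star (emb \<circ> pfst)"
    let ?A = "?\<alpha>(i := {star})"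
    let ?ez = "fmap F ?\<gamma> ?\<gamma>1 (\<lambda>_. emb) ?z"
    have f: "?f \<in> funs ?\<gamma>1 ?\<alpha>" by (auto simp: funs_def one_plus_eq prod_ty_def)
    have ez: "?ez \<in> carr F ?\<gamma>1" by (rule map_closed[OF types(5) \<gamma>1 emb_funs z])
    have "fmap F ?\<gamma>1 ?\<alpha> ?f ?ez = fmap F ?\<gamma> ?\<alpha> (\<lambda>_. emb \<circ> pfst) ?z"
      unfolding map_comp[OF types(5) \<gamma>1 types(3) emb_funs f z] by (simp add: comp_def)
    also have "\<dots> = fmap F \<alpha> ?\<alpha> (\<lambda>_. emb) (fmap F ?\<gamma> \<alpha> (\<lambda>_. pfst) ?z)"
      by (rule map_comp[OF types(5) \<alpha> types(3) pfst_funs emb_funs z, symmetric])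
    \<comment> \<open>Thus the image of \<open>?ez\<close> is equivalent to the first projection of
      \<open>w\<close>, whose support at \<open>i\<close> is at most \<open>star\<close> because
      \<open>R i\<close> is empty. This is the premise of (PP).\<close>
    finally have "(fmap F ?\<gamma>1 ?\<alpha> ?f ?ez, fmap F ?\<gamma>2 ?\<alpha> (\<lambda>_. pfst) w) \<in> E ?\<alpha>"
      using E_trans[OF types(3) E_map[OF \<alpha> types(3) emb_funs zx] xw] by simp
    moreover have w1: "fmap F ?\<gamma>2 ?\<alpha> (\<lambda>_. pfst) w \<in> carr F ?\<alpha>"
      by (rule map_closed[OF \<gamma>2 types(3) pfst_funs w])
    have "fset F ?\<alpha> i (fmap F ?\<gamma>2 ?\<alpha> (\<lambda>_. pfst) w) \<subseteq> {star}"
      using wR[of i] True unfolding set_map[OF \<gamma>2 types(3) pfst_funs w]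
      by (auto simp: rel_graph_def rel_one_plus_def)
    with w1 have "fmap F ?\<gamma>2 ?\<alpha> (\<lambda>_. pfst) w \<in> F_in F ?\<alpha> ?A"
      using set_closed[OF types(3) w1] by (auto simp: F_in_def)
    ultimately have "?ez \<in> map_vimage F ?\<gamma>1 ?\<alpha> ?f (\<Union>(F_in F ?\<alpha> ?A // E ?\<alpha>))"
      using ez E_sym[OF types(3)] by (auto simp: map_vimage_def quotient_def)
    moreover have "?A k \<subseteq> ?\<alpha> k \<and> {a \<in> ?\<gamma>1 k. ?f k a \<in> ?A k} \<noteq> {}" for k
      by (auto simp: one_plus_eq)
    ultimately have "?ez \<in> \<Union>(map_vimage F ?\<gamma>1 ?\<alpha> ?f (F_in F ?\<alpha> ?A) // E ?\<gamma>1)"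
      using pp[unfolded PP_def, rule_format, OF \<gamma>1 types(3) f, of ?A] by (meson subsetD)
    then obtain u where u: "(u, ?ez) \<in> E ?\<gamma>1" "u \<in> carr F ?\<gamma>1"
        "fmap F ?\<gamma>1 ?\<alpha> ?f u \<in> F_in F ?\<alpha> ?A"
      by (auto simp: map_vimage_def quotient_def)
    have "fset F ?\<alpha> i (fmap F ?\<gamma>1 ?\<alpha> ?f u) \<subseteq> ?A i"
      using u(3) by (simp only: F_in_def mem_Collect_eq)
    then have "?f i ` fset F ?\<gamma>1 i u \<subseteq> {star}"
      by (simp only: set_map[OF \<gamma>1 types(3) f u(2)] fun_upd_same)
    \<comment> \<open>\<open>?f\<close> sends embedded values to embedded values, so only
      \<open>star\<close> is mapped to \<open>star\<close>. Hence \<open>u\<close> is a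
      representative of the embedded \<open>?z\<close> with no embedded value at \<open>i\<close>,
      as \<open>Q_in_iff\<close> requires for an empty support.\<close>
    then have "fset F ?\<gamma>1 i u \<subseteq> {star}"
      using set_closed[OF \<gamma>1 u(2), of i] by (fastforce simp: one_plus_eq)
    then have "u \<in> F_in F ?\<gamma>1 (\<lambda>k. insert star (emb ` (?\<gamma>(i := rel_graph (R i))) k))"
      using u(2) set_closed[OF \<gamma>1 u(2)] by (auto simp: F_in_def one_plus_eq)
    then show ?thesis
      unfolding Q_in_iff[OF types(5) z] using E_sym[OF \<gamma>1 u(1)] by blast
  qed
  then have "E ?\<gamma> `` {?z} \<in> Q_in F E ?\<gamma> (\<lambda>i. rel_graph (R i))"
    by (rule Q_in_coordinates)
  then have "\<forall>i. set_Q F E ?\<gamma> i (E ?\<gamma> `` {?z}) \<subseteq> rel_graph (R i)"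
    by (subst set_Q_subset_iff[OF wi types(5) z RB])
  moreover have "map_Q F E ?\<gamma> \<alpha> (\<lambda>_. pfst) (E ?\<gamma> `` {?z}) = E \<alpha> `` {x}"
    using zx by (simp only: map_Q_eq_iff[OF types(5) \<alpha> pfst_funs z x])
  moreover have "map_Q F E ?\<gamma> \<beta> (\<lambda>_. psnd) (E ?\<gamma> `` {?z}) = E \<beta> `` {y}"
    using zy by (simp only: map_Q_eq_iff[OF types(5) \<beta> psnd_funs z y])
  ultimately show ?thesis
    using quotientI[OF z, of "E ?\<gamma>"] unfolding rel_Q_def by blast
qed

end

theorem theorem3p16:
  fixes T :: "'a val set set"
    and F :: "('n::finite, 'a, 'f) functor_ops"
    and bd :: "'b rel"
    and E :: "('n, 'a, 'f) poly_rel"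
    and \<alpha> \<beta> :: "('n, 'a) types"
    and R :: "'n \<Rightarrow> ('a val \<times> 'a val) set"
    and x y :: 'f
  assumes "type_universe T"
    and "BNF T F bd"
    and "poly_equiv T F E"
    and "map_compatible T F E"
    and "WI T F E"
    and "PP T F E"
    and "\<alpha> \<in> type_tuples T"
    and "\<beta> \<in> type_tuples T"
    and "R \<in> rels \<alpha> \<beta>"
    and "x \<in> carr F \<alpha>"
    and "y \<in> carr F \<beta>"
  shows "(E \<alpha> `` {x}, E \<beta> `` {y}) \<in> rel_Q F E \<alpha> \<beta> R \<longleftrightarrow>
    (fmap F \<alpha> (one_pluses \<alpha>) (\<lambda>_. emb) x, fmap F \<beta> (one_pluses \<beta>) (\<lambda>_. emb) y)
      \<in> E (one_pluses \<alpha>)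
          O rel_F F (one_pluses \<alpha>) (one_pluses \<beta>) (\<lambda>i. rel_one_plus (R i))
          O E (one_pluses \<beta>)"
proof -
  interpret BNF_quotient T F bd E
    using assms(1-4) by (intro BNF_quotient.intro BNF_quotient_axioms.intro)
  show ?thesis
  proof
    assume "(E \<alpha> `` {x}, E \<beta> `` {y}) \<in> rel_Q F E \<alpha> \<beta> R"
    then show "(fmap F \<alpha> (one_pluses \<alpha>) (\<lambda>_. emb) x, fmap F \<beta> (one_pluses \<beta>) (\<lambda>_. emb) y)
      \<in> E (one_pluses \<alpha>)
          O rel_F F (one_pluses \<alpha>) (one_pluses \<beta>) (\<lambda>i. rel_one_plus (R i))
          O E (one_pluses \<beta>)"
      by (rule rel_Q_imp_rel_F[OF assms(5,7-11)])
  next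
    assume "(fmap F \<alpha> (one_pluses \<alpha>) (\<lambda>_. emb) x, fmap F \<beta> (one_pluses \<beta>) (\<lambda>_. emb) y)
      \<in> E (one_pluses \<alpha>)
          O rel_F F (one_pluses \<alpha>) (one_pluses \<beta>) (\<lambda>i. rel_one_plus (R i))
          O E (one_pluses \<beta>)"
    then show "(E \<alpha> `` {x}, E \<beta> `` {y}) \<in> rel_Q F E \<alpha> \<beta> R"
      by (rule rel_F_imp_rel_Q[OF assms(5-11)])
  qed
qed

end
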